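(* Let $k$ be an algebraically closed field of characteristic $0$ and let $R=k\langle x,y\rangle/(xy-yx-y^2)$. Every finite-dimensional irreducible $R$-module is one-dimensional, and the modules $S_{\alpha}$, $\alpha\in k$, form a complete set of pairwise non-isomorphic finite-dimensional irreducible $R$-modules.
   Context: For $\alpha\in k$, $S_\alpha=(\alpha,0)$ denotes the one-dimensional $R$-module $k$ on which $x$ acts as multiplication by $\alpha$ and $y$ acts as $0$. *)

theory Defs
  imports
    "HOL-Computational_Algebra.Polynomial"
    "HOL-Library.Poly_Mapping"
begin

text \<open>
  Words form the free monoid under concatenation, so \<open>'v list \<Rightarrow>\<^sub>0 'k\<close>, with the convolution
  product of \<^theory>\<open>HOL-Library.Poly_Mapping\<close>, is the free associative \<open>'k\<close>-algebra on \<open>'v\<close>.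
\<close>

instantiation list :: (type) monoid_add
begin

definition zero_list :: "'a list" where "zero_list = []"

definition plus_list :: "'a list \<Rightarrow> 'a list \<Rightarrow> 'a list" where "plus_list = (@)"

instance
  by standard (simp_all add: zero_list_def plus_list_def)

end

definition free_gen :: "'v \<Rightarrow> 'v list \<Rightarrow>\<^sub>0 'k::comm_ring_1"
  where "free_gen v = Poly_Mapping.single [v] 1"

definition free_const :: "'k \<Rightarrow> 'v list \<Rightarrow>\<^sub>0 'k::comm_ring_1"
  where "free_const c = Poly_Mapping.single [] c"

definition free_eval :: "('v \<Rightarrow> 'k) \<Rightarrow> ('v list \<Rightarrow>\<^sub>0 'k::comm_ring_1) \<Rightarrow> 'k"
  where "free_eval a f =
    (\<Sum>w\<in>Poly_Mapping.keys f. Poly_Mapping.lookup f w * prod_list (map a w))"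

lemma free_eval_single [simp]: "free_eval a (Poly_Mapping.single w c) = c * prod_list (map a w)"
  by (simp add: free_eval_def)

lemma free_eval_const [simp]: "free_eval a (free_const c) = c"
  by (simp add: free_const_def)

lemma free_eval_gen [simp]: "free_eval a (free_gen v) = a v"
  by (simp add: free_gen_def)

lemma free_eval_zero [simp]: "free_eval a 0 = 0"
  by (simp add: free_eval_def)

lemma free_eval_add: "free_eval a (f + g) = free_eval a f + free_eval a g"
  unfolding free_eval_def
  by (rule setsum_keys_plus_distrib) (simp_all add: algebra_simps)

lemma free_eval_diff: "free_eval a (f - g) = free_eval a f - free_eval a g"
  using free_eval_add [of a "f - g" g] by simp

lemma free_eval_one [simp]: "free_eval a 1 = 1"
  by (metis free_eval_const free_const_def single_one zero_list_def)

lemma free_eval_sum: "free_eval a (sum f A) = (\<Sum>i\<in>A. free_eval a (f i))"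
  by (induction A rule: infinite_finite_induct) (simp_all add: free_eval_add)

lemma free_alg_sum_words:
  "f = (\<Sum>w\<in>Poly_Mapping.keys f. Poly_Mapping.single w (Poly_Mapping.lookup f w))"
  by (rule poly_mapping_eqI)
    (auto simp: lookup_sum lookup_single when_def not_in_keys_iff_lookup_eq_zero)

lemma free_eval_mult: "free_eval a (f * g) = free_eval a f * free_eval a g"
proof -
  have "f * g = (\<Sum>u\<in>Poly_Mapping.keys f. \<Sum>v\<in>Poly_Mapping.keys g.
      Poly_Mapping.single (u + v) (Poly_Mapping.lookup f u * Poly_Mapping.lookup g v))"
    by (subst free_alg_sum_words [of f], subst free_alg_sum_words [of g])
      (simp add: sum_product mult_single)
  then show ?thesis
    by (simp add: free_eval_sum plus_list_def free_eval_def [of a f] free_eval_def [of a g]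
        sum_product mult_ac)
qed

definition two_sided_ideal :: "'r::ring_1 set \<Rightarrow> bool"
  where "two_sided_ideal I \<longleftrightarrow>
    0 \<in> I \<and> (\<forall>a\<in>I. \<forall>b\<in>I. a - b \<in> I) \<and> (\<forall>a\<in>I. \<forall>r. r * a \<in> I \<and> a * r \<in> I)"

definition generated_ideal :: "'r::ring_1 set \<Rightarrow> 'r set"
  where "generated_ideal S = \<Inter>{I. two_sided_ideal I \<and> S \<subseteq> I}"

lemma two_sided_ideal_generated: "two_sided_ideal (generated_ideal S)"
  unfolding generated_ideal_def two_sided_ideal_def by blast

lemma generated_ideal_superset: "S \<subseteq> generated_ideal S"
  unfolding generated_ideal_def by blast

lemma generated_ideal_least: "two_sided_ideal I \<Longrightarrow> S \<subseteq> I \<Longrightarrow> generated_ideal S \<subseteq> I"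
  unfolding generated_ideal_def by blast

datatype gen = X | Y

definition relation_ideal :: "(gen list \<Rightarrow>\<^sub>0 'k::field) set"
  where "relation_ideal =
    generated_ideal {free_gen X * free_gen Y - free_gen Y * free_gen X - free_gen Y ^ 2}"

lemma relation_ideal_zero: "0 \<in> relation_ideal"
  and relation_ideal_diff: "f \<in> relation_ideal \<Longrightarrow> g \<in> relation_ideal \<Longrightarrow> f - g \<in> relation_ideal"
  and relation_ideal_left: "f \<in> relation_ideal \<Longrightarrow> h * f \<in> relation_ideal"
  and relation_ideal_right: "f \<in> relation_ideal \<Longrightarrow> f * h \<in> relation_ideal"
  using two_sided_ideal_generated unfolding relation_ideal_def two_sided_ideal_def by blast+

lemma relation_ideal_minus: "f \<in> relation_ideal \<Longrightarrow> - f \<in> relation_ideal"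
  using relation_ideal_diff [OF relation_ideal_zero] by simp

lemma relation_ideal_add:
  "f \<in> relation_ideal \<Longrightarrow> g \<in> relation_ideal \<Longrightarrow> f + g \<in> relation_ideal"
  using relation_ideal_diff [OF _ relation_ideal_minus, of f g] by simp

lemma free_eval_relation_ideal:
  assumes "f \<in> relation_ideal" and "a Y = (0::'k::field)"
  shows "free_eval a f = 0"
proof -
  have "two_sided_ideal {f. free_eval a f = 0}"
    by (simp add: two_sided_ideal_def free_eval_diff free_eval_mult)
  moreover have "{free_gen X * free_gen Y - free_gen Y * free_gen X - free_gen Y ^ 2}
      \<subseteq> {f. free_eval a f = 0}"
    using assms(2) by (simp add: free_eval_diff free_eval_mult power2_eq_square)
  ultimately show ?thesis
    using assms(1) generated_ideal_least unfolding relation_ideal_def by blast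
qed

text \<open>The algebra \<open>R = k\<langle>x, y\<rangle> / (xy - yx - y\<^sup>2)\<close>.\<close>

quotient_type (overloaded) 'k jordan_plane = "gen list \<Rightarrow>\<^sub>0 'k::field" /
  "\<lambda>f g. f - g \<in> relation_ideal"
proof (rule equivpI)
  show "reflp (\<lambda>f g :: gen list \<Rightarrow>\<^sub>0 'k. f - g \<in> relation_ideal)"
    by (simp add: reflp_def relation_ideal_zero)
  show "symp (\<lambda>f g :: gen list \<Rightarrow>\<^sub>0 'k. f - g \<in> relation_ideal)"
    using relation_ideal_minus [of "f - g" for f g] by (simp add: symp_def) blast
  show "transp (\<lambda>f g :: gen list \<Rightarrow>\<^sub>0 'k. f - g \<in> relation_ideal)"
    using relation_ideal_add [of "f - g" "g - h" for f g h] by (simp add: transp_def) blast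
qed

instantiation jordan_plane :: (field) ring_1
begin

lift_definition zero_jordan_plane :: "'a jordan_plane" is 0 .

lift_definition one_jordan_plane :: "'a jordan_plane" is 1 .

lift_definition plus_jordan_plane :: "'a jordan_plane \<Rightarrow> 'a jordan_plane \<Rightarrow> 'a jordan_plane" is "(+)"
  by (subst add_diff_add) (rule relation_ideal_add)

lift_definition uminus_jordan_plane :: "'a jordan_plane \<Rightarrow> 'a jordan_plane" is uminus
  by (subst minus_diff_minus) (rule relation_ideal_minus)

lift_definition minus_jordan_plane :: "'a jordan_plane \<Rightarrow> 'a jordan_plane \<Rightarrow> 'a jordan_plane" is "(-)"
proof -
  fix f f' g g' :: "gen list \<Rightarrow>\<^sub>0 'a"
  assume "f - f' \<in> relation_ideal" "g - g' \<in> relation_ideal"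
  then have "(f - f') - (g - g') \<in> relation_ideal"
    by (rule relation_ideal_diff)
  then show "(f - g) - (f' - g') \<in> relation_ideal"
    by (simp add: algebra_simps)
qed

lift_definition times_jordan_plane :: "'a jordan_plane \<Rightarrow> 'a jordan_plane \<Rightarrow> 'a jordan_plane" is "(*)"
proof -
  fix f f' g g' :: "gen list \<Rightarrow>\<^sub>0 'a"
  assume "f - f' \<in> relation_ideal" "g - g' \<in> relation_ideal"
  then have "f * (g - g') + (f - f') * g' \<in> relation_ideal"
    by (intro relation_ideal_add relation_ideal_left relation_ideal_right)
  then show "f * g - f' * g' \<in> relation_ideal"
    by (simp add: algebra_simps)
qed

instance
proof
  fix a b c :: "'a jordan_plane"
  show "a + b + c = a + (b + c)" by transfer (simp add: relation_ideal_zero add.assoc)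
  show "a + b = b + a" by transfer (simp add: relation_ideal_zero add.commute)
  show "0 + a = a" by transfer (simp add: relation_ideal_zero)
  show "- a + a = 0" by transfer (simp add: relation_ideal_zero)
  show "a - b = a + - b" by transfer (simp add: relation_ideal_zero)
  show "a * b * c = a * (b * c)" by transfer (simp add: relation_ideal_zero mult.assoc)
  show "1 * a = a" by transfer (simp add: relation_ideal_zero)
  show "a * 1 = a" by transfer (simp add: relation_ideal_zero)
  show "(a + b) * c = a * c + b * c" by transfer (simp add: relation_ideal_zero distrib_right)
  show "a * (b + c) = a * b + a * c" by transfer (simp add: relation_ideal_zero distrib_left)
  show "(0::'a jordan_plane) \<noteq> 1"
  proof (transfer, rule notI)
    assume "(0 :: gen list \<Rightarrow>\<^sub>0 'a) - 1 \<in> relation_ideal"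
    then have "free_eval (\<lambda>_. 0) (0 - 1 :: gen list \<Rightarrow>\<^sub>0 'a) = 0"
      by (rule free_eval_relation_ideal) simp
    then show False by (simp only: free_eval_diff) simp
  qed
qed

end

lift_definition jp_x :: "'k::field jordan_plane" is "free_gen X" .

lift_definition jp_y :: "'k::field jordan_plane" is "free_gen Y" .

lift_definition jp_scalar :: "'k::field \<Rightarrow> 'k jordan_plane" is free_const .

lemma jp_relation: "jp_x * jp_y - jp_y * jp_x = jp_y ^ 2"
  unfolding power2_eq_square
  by transfer
    (use generated_ideal_superset in \<open>force simp: relation_ideal_def power2_eq_square\<close>)

text \<open>
  The locale \<^locale>\<open>module\<close> of \<^theory>\<open>HOL.Modules\<close> needs commutative scalars. Here a left module
  over a possibly noncommutative ring is given by its action on an additive group type.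
\<close>

locale left_module =
  fixes act :: "'r::ring_1 \<Rightarrow> 'm::ab_group_add \<Rightarrow> 'm"
  assumes act_add_right: "act r (u + v) = act r u + act r v"
    and act_add_left: "act (r + s) v = act r v + act s v"
    and act_mult: "act (r * s) v = act r (act s v)"
    and act_one: "act 1 v = v"

definition submodule :: "('r::ring_1 \<Rightarrow> 'm::ab_group_add \<Rightarrow> 'm) \<Rightarrow> 'm set \<Rightarrow> bool"
  where "submodule act N \<longleftrightarrow>
    0 \<in> N \<and> (\<forall>u\<in>N. \<forall>v\<in>N. u + v \<in> N) \<and> (\<forall>r. \<forall>v\<in>N. act r v \<in> N)"

definition irreducible_module :: "('r::ring_1 \<Rightarrow> 'm::ab_group_add \<Rightarrow> 'm) \<Rightarrow> bool"
  where "irreducible_module act \<longleftrightarrow>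
    left_module act \<and> (UNIV :: 'm set) \<noteq> {0} \<and> (\<forall>N. submodule act N \<longrightarrow> N = {0} \<or> N = UNIV)"

definition isomorphic_modules ::
    "('r::ring_1 \<Rightarrow> 'm::ab_group_add \<Rightarrow> 'm) \<Rightarrow> ('r \<Rightarrow> 'n::ab_group_add \<Rightarrow> 'n) \<Rightarrow> bool"
  where "isomorphic_modules act act' \<longleftrightarrow>
    (\<exists>h. bij h \<and> (\<forall>u v. h (u + v) = h u + h v) \<and> (\<forall>r v. h (act r v) = act' r (h v)))"

definition jp_scale :: "('k::field jordan_plane \<Rightarrow> 'm::ab_group_add \<Rightarrow> 'm) \<Rightarrow> 'k \<Rightarrow> 'm \<Rightarrow> 'm"
  where "jp_scale act c = act (jp_scalar c)"

lemma vector_space_jp_scale: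
  assumes "left_module act"
  shows "vector_space (jp_scale act)"
proof -
  interpret left_module act by fact
  have [simp]: "jp_scalar (a + b) = jp_scalar a + jp_scalar b" for a b :: 'a
    by transfer (simp add: free_const_def single_add relation_ideal_zero)
  have [simp]: "jp_scalar (a * b) = jp_scalar a * jp_scalar b" for a b :: 'a
    by transfer (simp add: free_const_def mult_single plus_list_def relation_ideal_zero)
  have [simp]: "jp_scalar (1::'a) = 1"
    by transfer (simp add: free_const_def flip: zero_list_def, simp add: relation_ideal_zero)
  show ?thesis
    by standard (simp_all add: jp_scale_def act_add_right act_add_left act_mult act_one)
qed

definition finite_dimensional_module :: "('k::field jordan_plane \<Rightarrow> 'm::ab_group_add \<Rightarrow> 'm) \<Rightarrow> bool"
  where "finite_dimensional_module act \<longleftrightarrow> (\<exists>B. finite_dimensional_vector_space (jp_scale act) B)"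

definition module_dim :: "('k::field jordan_plane \<Rightarrow> 'm::ab_group_add \<Rightarrow> 'm) \<Rightarrow> nat"
  where "module_dim act = vector_space.dim (jp_scale act) UNIV"

text \<open>The module \<open>S\<^sub>\<alpha> = (\<alpha>, 0)\<close>, with underlying space \<open>k\<close>.\<close>

lift_definition S_mod :: "'k::field \<Rightarrow> 'k jordan_plane \<Rightarrow> 'k \<Rightarrow> 'k"
  is "\<lambda>\<alpha> f v. free_eval (case_gen \<alpha> 0) f * v"
proof -
  fix \<alpha> :: 'k and f g :: "gen list \<Rightarrow>\<^sub>0 'k"
  assume "f - g \<in> relation_ideal"
  then have "free_eval (case_gen \<alpha> 0) (f - g) = 0"
    by (rule free_eval_relation_ideal) simp
  then show "(\<lambda>v. free_eval (case_gen \<alpha> 0) f * v) = (\<lambda>v. free_eval (case_gen \<alpha> 0) g * v)"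
    by (simp add: free_eval_diff)
qed

lemma left_module_S_mod: "left_module (S_mod \<alpha>)"
  by standard
    (transfer, simp add: free_eval_add free_eval_mult algebra_simps)+

lemma S_mod_x: "S_mod \<alpha> jp_x v = \<alpha> * v"
  by transfer simp

lemma S_mod_y: "S_mod \<alpha> jp_y v = 0"
  by transfer simp

lemma S_mod_scalar: "jp_scale (S_mod \<alpha>) c v = c * v"
  unfolding jp_scale_def by transfer simp

end

theory Submission
  imports Defs
begin

text \<open>
  Let \<open>V\<close> be a finite-dimensional irreducible module. The relation \<open>xy - yx = y\<^sup>2\<close> says that
  \<open>[x, p(y)] = y\<^sup>2 p'(y)\<close> for every polynomial \<open>p\<close> (\<open>jp_x_eval_y\<close>). Over an algebraically
  closed field \<open>x\<close> has an eigenvector \<open>v\<close> in \<open>V\<close>; applying this identity to \<open>v\<close> with \<open>p\<close> of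
  least degree such that \<open>p(y) v = 0\<close> gives \<open>y\<^sup>2 p'(y) v = 0\<close>. In characteristic \<open>0\<close> the
  minimality of \<open>p\<close> forbids \<open>p'(y) v = 0\<close>, so \<open>y\<close> has a nonzero kernel (\<open>y_not_injective\<close>).
  The relation also makes this kernel a submodule (\<open>submodule_kernel_y\<close>), and
  irreducibility forces \<open>y = 0\<close> on \<open>V\<close>.

  The line through the eigenvector \<open>v\<close> of \<open>x\<close> is then stable under the generators, hence is
  all of \<open>V\<close>, and \<open>V\<close> is \<open>S\<^sub>\<alpha>\<close> for the eigenvalue \<open>\<alpha>\<close>. The eigenvalue is recovered from the
  isomorphism class because a module isomorphism commutes with both \<open>x\<close> and the scalars.
\<close>

section \<open>The algebra is generated by scalars, \<open>x\<close> and \<open>y\<close>\<close>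

lemma jp_scalar_0 [simp]: "jp_scalar 0 = 0"
  by transfer (simp add: free_const_def relation_ideal_zero)

lemma jp_scalar_1 [simp]: "jp_scalar 1 = 1"
  by transfer (simp add: free_const_def relation_ideal_zero flip: zero_list_def)

lemma jp_scalar_add: "jp_scalar (a + b) = jp_scalar a + jp_scalar b"
  by transfer (simp add: free_const_def single_add relation_ideal_zero)

lemma jp_scalar_mult: "jp_scalar (a * b) = jp_scalar a * jp_scalar b"
  by transfer (simp add: free_const_def mult_single plus_list_def relation_ideal_zero)

text \<open>
  This reduces statements about the action of all of \<open>R\<close> to the generators. Left
  multiplication by \<open>x\<close> and \<open>y\<close> suffices because each word is built by prepending letters.
\<close>

lemma jordan_plane_induct [case_names scalar add x y]:
  assumes scalar: "\<And>c. P (jp_scalar c)"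
    and add: "\<And>r s. P r \<Longrightarrow> P s \<Longrightarrow> P (r + s)"
    and x: "\<And>r. P r \<Longrightarrow> P (jp_x * r)"
    and y: "\<And>r. P r \<Longrightarrow> P (jp_y * r)"
  shows "P (r :: 'k::field jordan_plane)"
proof -
  have word: "P (abs_jordan_plane (Poly_Mapping.single w c))" for w and c :: 'k
  proof (induction w)
    case Nil
    then show ?case
      using scalar[of c] by (simp add: jp_scalar_def free_const_def)
  next
    case (Cons g w)
    have split: "Poly_Mapping.single (g # w) c = free_gen g * Poly_Mapping.single w c"
      by (simp add: free_gen_def mult_single plus_list_def)
    show ?case
      using x[OF Cons] y[OF Cons] unfolding split jp_x_def jp_y_def
      by (cases g) (simp_all add: times_jordan_plane.abs_eq)
  qed
  have "P (abs_jordan_plane (\<Sum>w\<in>A. Poly_Mapping.single w (u w)))"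
    if "finite A" for A and u :: "gen list \<Rightarrow> 'k"
    using that
  proof induction
    case empty
    show ?case
      using word[of "[]" 0] by simp
  next
    case (insert w A)
    then show ?case
      using add[OF word[of w "u w"] insert.IH] by (simp add: plus_jordan_plane.abs_eq)
  qed
  then have "P (abs_jordan_plane f)" for f
    by (subst free_alg_sum_words) simp
  then show ?thesis
    by (rule jordan_plane.abs_induct)
qed

lemma jp_scalar_commutes: "jp_scalar c * r = r * jp_scalar c"
proof (induction r rule: jordan_plane_induct)
  case (scalar d)
  show ?case
    by (metis jp_scalar_mult mult.commute)
next
  case (add r s)
  then show ?case
    by (simp add: algebra_simps)
next
  case (x r)
  have "jp_scalar c * jp_x = jp_x * jp_scalar c"
    by transfer (simp add: free_const_def free_gen_def mult_single plus_list_def relation_ideal_zero)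
  then show ?case
    by (metis x mult.assoc)
next
  case (y r)
  have "jp_scalar c * jp_y = jp_y * jp_scalar c"
    by transfer (simp add: free_const_def free_gen_def mult_single plus_list_def relation_ideal_zero)
  then show ?case
    by (metis y mult.assoc)
qed

section \<open>Polynomials in one element of the algebra\<close>

text \<open>
  The value \<open>p(r)\<close>, by Horner's rule; \<open>poly\<close> requires the coefficients and the argument to
  lie in one commutative ring.
\<close>

definition jp_eval :: "'k::field poly \<Rightarrow> 'k jordan_plane \<Rightarrow> 'k jordan_plane"
  where "jp_eval p r = fold_coeffs (\<lambda>a s. jp_scalar a + r * s) p 0"

lemma jp_eval_0 [simp]: "jp_eval 0 r = 0"
  by (simp add: jp_eval_def)

lemma jp_eval_pCons [simp]: "jp_eval (pCons a p) r = jp_scalar a + r * jp_eval p r"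
  by (cases "p = 0 \<and> a = 0") (auto simp: jp_eval_def)

lemma jp_eval_add: "jp_eval (p + q) r = jp_eval p r + jp_eval q r"
  by (induction p q rule: poly_induct2) (simp_all add: jp_scalar_add algebra_simps)

lemma jp_eval_diff: "jp_eval (p - q) r = jp_eval p r - jp_eval q r"
  using jp_eval_add[of "p - q" q r] by simp

lemma jp_eval_smult: "jp_eval (smult c p) r = jp_scalar c * jp_eval p r"
proof (induction p)
  case 0
  show ?case by simp
next
  case (pCons a p)
  have "r * (jp_scalar c * jp_eval p r) = jp_scalar c * (r * jp_eval p r)"
    by (metis jp_scalar_commutes mult.assoc)
  with pCons show ?case
    by (simp add: jp_scalar_mult distrib_left)
qed

lemma jp_eval_mult: "jp_eval (p * q) r = jp_eval p r * jp_eval q r"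
  by (induction p) (simp_all add: jp_eval_add jp_eval_smult distrib_right mult.assoc)

lemma jp_eval_monom: "jp_eval (monom 1 n) r = r ^ n"
  by (induction n) (simp_all add: monom_0 monom_Suc)

text \<open>
  The defining relation says that the commutator with \<open>x\<close> is the derivation \<open>y\<^sup>2 d/dy\<close>
  on polynomials in \<open>y\<close>.
\<close>

lemma jp_x_eval_y:
  "jp_x * jp_eval p jp_y = jp_eval p jp_y * jp_x + jp_y ^ 2 * jp_eval (pderiv p) jp_y"
proof (induction p)
  case 0
  show ?case by simp
next
  case (pCons a p)
  let ?P = "jp_eval p jp_y" and ?P' = "jp_eval (pderiv p) jp_y"
  have xy: "jp_x * jp_y = jp_y * jp_x + (jp_y :: 'a jordan_plane) ^ 2"
    using jp_relation by (metis add.commute diff_add_cancel)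
  have "jp_x * jp_eval (pCons a p) jp_y = jp_scalar a * jp_x + jp_x * jp_y * ?P"
    by (simp add: distrib_left mult.assoc jp_scalar_commutes[of a jp_x])
  also have "\<dots> = jp_scalar a * jp_x + jp_y * (jp_x * ?P) + jp_y ^ 2 * ?P"
    unfolding xy by (simp add: algebra_simps)
  also have "\<dots> = jp_eval (pCons a p) jp_y * jp_x + jp_y ^ 2 * (?P + jp_y * ?P')"
    unfolding pCons.IH by (simp add: algebra_simps power2_eq_square)
  also have "?P + jp_y * ?P' = jp_eval (pderiv (pCons a p)) jp_y"
    by (simp add: pderiv_pCons jp_eval_add)
  finally show ?case .
qed

section \<open>Finite-dimensional modules\<close>

text \<open>
  Otherwise all finite prefixes of the sequence would be independent and without repetition,
  so their lengths would exceed the dimension. Applied to the sequence of \<open>r\<^sup>n v\<close>, this yields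
  a polynomial in \<open>r\<close> that annihilates \<open>v\<close>.
\<close>

lemma (in finite_dimensional_vector_space) sequence_hits_earlier_span:
  fixes f :: "nat \<Rightarrow> 'b"
  obtains n where "f n \<in> span (f ` {..<n})"
proof -
  have False if none: "\<And>n. f n \<notin> span (f ` {..<n})"
  proof -
    have indep: "independent (f ` {..<n}) \<and> card (f ` {..<n}) = n" for n
    proof (induction n)
      case 0
      show ?case by (simp add: independent_empty)
    next
      case (Suc n)
      moreover have "f n \<notin> f ` {..<n}"
        by (metis none span_base)
      ultimately show ?case
        using none by (simp add: lessThan_Suc independent_insertI)
    qed
    then have "Suc (dim UNIV) \<le> dim UNIV"
      using independent_card_le_dim[of "f ` {..<Suc (dim UNIV)}" UNIV] by (metis subset_UNIV)
    then show False by simp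
  qed
  with that show thesis by blast
qed

context left_module
begin

lemma act_zero_right [simp]: "act r 0 = 0"
  using act_add_right[of r 0 0] by simp

lemma act_zero_left [simp]: "act 0 v = 0"
  using act_add_left[of 0 0 v] by simp

lemma act_diff_left: "act (r - s) v = act r v - act s v"
  using act_add_left[of "r - s" s v] by simp

end

locale jordan_plane_module = left_module act
  for act :: "'k::field jordan_plane \<Rightarrow> 'm::ab_group_add \<Rightarrow> 'm"
begin

sublocale vs: vector_space "jp_scale act"
  by (rule vector_space_jp_scale) (rule left_module_axioms)

text \<open>
  The condition on the \<open>n\<close>-th coefficient guarantees that \<open>t\<^sup>n - q\<close> is nonzero.
\<close>

lemma span_powers_eval:
  assumes "w \<in> vs.span ((\<lambda>i. act (r ^ i) v) ` {..<n})"
  shows "\<exists>q. coeff q n = 0 \<and> w = act (jp_eval q r) v"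
  using assms
proof (induction rule: vs.span_induct_alt)
  case base
  show ?case by (intro exI[of _ 0]) simp
next
  case (step c u w)
  then obtain i q where i: "i < n" "u = act (r ^ i) v"
    and q: "coeff q n = 0" "w = act (jp_eval q r) v"
    by auto
  then show ?case
    using i q by (intro exI[of _ "smult c (monom 1 i) + q"])
      (simp add: jp_eval_add jp_eval_smult jp_eval_monom jp_scale_def act_add_left act_mult)
qed

lemma annihilating_poly_exists:
  assumes "finite_dimensional_module act"
  shows "\<exists>p. p \<noteq> 0 \<and> act (jp_eval p r) v = 0"
proof -
  obtain B where "finite_dimensional_vector_space (jp_scale act) B"
    using assms unfolding finite_dimensional_module_def by blast
  then interpret fd: finite_dimensional_vector_space "jp_scale act" B .
  obtain n where "act (r ^ n) v \<in> vs.span ((\<lambda>i. act (r ^ i) v) ` {..<n})"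
    by (rule fd.sequence_hits_earlier_span)
  then obtain q where q: "coeff q n = 0" "act (r ^ n) v = act (jp_eval q r) v"
    using span_powers_eval by blast
  have "coeff (monom 1 n - q) n = 1"
    using q by simp
  then have "monom 1 n - q \<noteq> 0"
    by (metis coeff_0 zero_neq_one)
  moreover have "act (jp_eval (monom 1 n - q) r) v = 0"
    using q by (simp add: jp_eval_diff jp_eval_monom act_diff_left)
  ultimately show ?thesis by blast
qed

lemma minimal_annihilating_poly:
  assumes "finite_dimensional_module act"
  obtains p where "p \<noteq> 0" "act (jp_eval p r) v = 0"
    and "\<And>q. q \<noteq> 0 \<Longrightarrow> degree q < degree p \<Longrightarrow> act (jp_eval q r) v \<noteq> 0"
proof -
  let ?Q = "\<lambda>p. p \<noteq> 0 \<and> act (jp_eval p r) v = 0"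
  obtain p0 where "?Q p0"
    using annihilating_poly_exists[OF assms] by blast
  then have "\<exists>p. ?Q p \<and> (\<forall>q. ?Q q \<longrightarrow> degree p \<le> degree q)"
    by (rule ex_has_least_nat)
  then obtain p where p: "?Q p \<and> (\<forall>q. ?Q q \<longrightarrow> degree p \<le> degree q)" ..
  show thesis
  proof (rule that)
    show "p \<noteq> 0" "act (jp_eval p r) v = 0"
      using p by simp_all
    show "act (jp_eval q r) v \<noteq> 0" if "q \<noteq> 0" "degree q < degree p" for q
      using p[THEN conjunct2, rule_format, of q] that by (meson not_le)
  qed
qed

lemma annihilating_poly_degree_pos:
  assumes "p \<noteq> 0" "act (jp_eval p r) v = 0" "v \<noteq> 0"
  shows "degree p > 0"
proof (rule ccontr)
  assume "\<not> degree p > 0"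
  then obtain a where "p = [:a:]"
    by (metis degree_eq_zeroE gr0I)
  with assms show False
    using vs.scale_eq_0_iff[of a v] by (simp add: jp_scale_def)
qed

text \<open>
  By \<open>yx = (x - y)y\<close>, the kernel of \<open>y\<close> is stable under \<open>x\<close>.
\<close>

lemma submodule_kernel_y: "submodule act {v. act jp_y v = 0}"
proof -
  have yx: "jp_y * jp_x = (jp_x - jp_y) * (jp_y :: 'k jordan_plane)"
    using jp_relation[where 'a = 'k] by (simp add: algebra_simps power2_eq_square)
  have "\<forall>v. act jp_y v = 0 \<longrightarrow> act jp_y (act r v) = 0" for r
  proof (induction r rule: jordan_plane_induct)
    case (scalar c)
    show ?case
      by (metis act_mult act_zero_right jp_scalar_commutes)
  next
    case (add r s)
    then show ?case by (simp add: act_add_left act_add_right)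
  next
    case (x r)
    then show ?case by (metis act_mult act_zero_right yx)
  next
    case (y r)
    then show ?case by (simp add: act_mult)
  qed
  then show ?thesis
    by (simp add: submodule_def act_add_right)
qed

text \<open>
  A common eigenvector of \<open>x\<close> and \<open>y\<close> with eigenvalues \<open>\<alpha>\<close> and \<open>0\<close> spans a copy
  of \<open>S\<^sub>\<alpha>\<close>; an element \<open>r\<close> acts on \<open>S\<^sub>\<alpha>\<close> as multiplication by the image of \<open>1\<close>.
\<close>

lemma act_common_eigenvector:
  assumes "act jp_x v = jp_scale act \<alpha> v" "act jp_y v = 0"
  shows "act r v = jp_scale act (S_mod \<alpha> r 1) v"
proof -
  interpret S: left_module "S_mod \<alpha>" by (rule left_module_S_mod)
  have S_scalar: "S_mod \<alpha> (jp_scalar c) u = c * u" for c u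
    using S_mod_scalar[of \<alpha> c u] by (simp add: jp_scale_def)
  show ?thesis
  proof (induction r rule: jordan_plane_induct)
    case (scalar c)
    show ?case by (simp add: S_scalar) (simp add: jp_scale_def)
  next
    case (add r s)
    then show ?case
      by (simp add: act_add_left S.act_add_left vs.scale_left_distrib)
  next
    case (x r)
    have "act (jp_x * r) v = jp_scale act (S_mod \<alpha> r 1) (act jp_x v)"
      unfolding act_mult x jp_scale_def by (metis act_mult jp_scalar_commutes)
    also have "\<dots> = jp_scale act (S_mod \<alpha> (jp_x * r) 1) v"
      by (simp add: assms S.act_mult S_mod_x mult.commute)
    finally show ?case .
  next
    case (y r)
    have "act (jp_y * r) v = jp_scale act (S_mod \<alpha> r 1) (act jp_y v)"
      unfolding act_mult y jp_scale_def by (metis act_mult jp_scalar_commutes)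
    then show ?case
      by (simp add: assms S.act_mult S_mod_y)
  qed
qed

end

text \<open>
  If \<open>p = (t - \<alpha>) q\<close> is a minimal polynomial annihilating a nonzero vector \<open>v\<close> under \<open>x\<close>,
  then \<open>q(x) v\<close> is nonzero by minimality and is an eigenvector.
\<close>

lemma x_eigenvector_exists:
  fixes act :: "'k::alg_closed_field jordan_plane \<Rightarrow> 'm::ab_group_add \<Rightarrow> 'm"
  assumes "jordan_plane_module act" "finite_dimensional_module act" "(v :: 'm) \<noteq> 0"
  obtains \<alpha> w where "w \<noteq> 0" "act jp_x w = jp_scale act \<alpha> w"
proof -
  interpret jordan_plane_module act by fact
  obtain p where p: "p \<noteq> 0" "act (jp_eval p jp_x) v = 0"
    and least: "\<And>q. q \<noteq> 0 \<Longrightarrow> degree q < degree p \<Longrightarrow> act (jp_eval q jp_x) v \<noteq> 0"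
    using minimal_annihilating_poly[OF assms(2)] by metis
  obtain \<alpha> where "poly p \<alpha> = 0"
    using alg_closed_imp_poly_has_root annihilating_poly_degree_pos[OF p assms(3)] by blast
  then obtain q where q: "p = [:- \<alpha>, 1:] * q"
    by (metis poly_eq_0_iff_dvd dvdE)
  define w where "w = act (jp_eval q jp_x) v"
  have "q \<noteq> 0" using p q by auto
  moreover from this have "degree q < degree p"
    by (simp add: q degree_mult_eq del: mult_pCons_left)
  ultimately have "w \<noteq> 0"
    using least by (simp add: w_def)
  have "jp_eval [:- \<alpha>, 1:] jp_x = jp_x - jp_scalar \<alpha>"
    using jp_scalar_add[of "- \<alpha>" \<alpha>] by (simp add: eq_neg_iff_add_eq_0)
  then have "act (jp_x - jp_scalar \<alpha>) w = 0"
    using p(2) unfolding q jp_eval_mult w_def act_mult by simp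
  then have "act jp_x w = jp_scale act \<alpha> w"
    by (simp add: act_diff_left jp_scale_def)
  with \<open>w \<noteq> 0\<close> show thesis by (rule that)
qed

text \<open>
  Were \<open>y\<close> injective, a minimal polynomial \<open>p\<close> with \<open>p(y) v = 0\<close> would give
  \<open>0 = x p(y) v = \<alpha> p(y) v + y\<^sup>2 p'(y) v\<close>, hence \<open>p'(y) v = 0\<close>. In characteristic
  \<open>0\<close> the derivative \<open>p'\<close> is nonzero and of smaller degree, against minimality. The
  choice of an eigenvector of \<open>x\<close> is what makes a minimal polynomial at a single vector
  suffice, in place of one for the whole operator \<open>y\<close>.
\<close>

lemma y_not_injective:
  fixes act :: "'k::field_char_0 jordan_plane \<Rightarrow> 'm::ab_group_add \<Rightarrow> 'm"
  assumes "jordan_plane_module act" "finite_dimensional_module act"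
    and v: "v \<noteq> 0" "act jp_x v = jp_scale act \<alpha> v"
  shows "\<exists>u. u \<noteq> 0 \<and> act jp_y u = 0"
proof (rule ccontr)
  assume "\<not> ?thesis"
  then have inj: "u = 0" if "act jp_y u = 0" for u
    using that by blast
  interpret jordan_plane_module act by fact
  obtain p where p: "p \<noteq> 0" "act (jp_eval p jp_y) v = 0"
    and least: "\<And>q. q \<noteq> 0 \<Longrightarrow> degree q < degree p \<Longrightarrow> act (jp_eval q jp_y) v \<noteq> 0"
    using minimal_annihilating_poly[OF assms(2)] by metis
  have deg: "degree p > 0"
    using annihilating_poly_degree_pos[OF p v(1)] .
  have "act (jp_eval p jp_y) (act jp_x v) = jp_scale act \<alpha> (act (jp_eval p jp_y) v)"
    unfolding v(2) jp_scale_def by (metis act_mult jp_scalar_commutes)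
  then have "act (jp_eval p jp_y * jp_x) v = 0"
    by (simp add: p act_mult)
  moreover have "act (jp_x * jp_eval p jp_y) v = 0"
    by (simp add: p act_mult)
  ultimately have "act jp_y (act jp_y (act (jp_eval (pderiv p) jp_y) v)) = 0"
    by (simp add: jp_x_eval_y act_add_left act_mult power2_eq_square)
  then have "act (jp_eval (pderiv p) jp_y) v = 0"
    using inj by blast
  moreover have "pderiv p \<noteq> 0" "degree (pderiv p) < degree p"
    using deg by (auto simp: pderiv_eq_0_iff degree_pderiv)
  ultimately show False
    using least by blast
qed

section \<open>Classification\<close>

lemma irreducible_finite_dimensional_jordan_plane:
  fixes act :: "'k::{alg_closed_field,field_char_0} jordan_plane \<Rightarrow> 'm::ab_group_add \<Rightarrow> 'm"
  assumes irr: "irreducible_module act" and fin: "finite_dimensional_module act"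
  shows "module_dim act = 1" and "\<exists>\<alpha>. isomorphic_modules act (S_mod \<alpha>)"
proof -
  have lm: "left_module act" and nontriv: "(UNIV :: 'm set) \<noteq> {0}"
    and simple: "\<And>N. submodule act N \<Longrightarrow> N = {0} \<or> N = UNIV"
    using irr unfolding irreducible_module_def by blast+
  interpret jordan_plane_module act
    using lm by (simp add: jordan_plane_module_def)
  obtain v0 :: 'm where "v0 \<noteq> 0"
    using nontriv by blast
  obtain \<alpha> v where v: "v \<noteq> 0" "act jp_x v = jp_scale act \<alpha> v"
    using x_eigenvector_exists[OF jordan_plane_module_axioms fin \<open>v0 \<noteq> 0\<close>] .
  have "{u. act jp_y u = 0} \<noteq> {0}"
    using y_not_injective[OF jordan_plane_module_axioms fin v] by blast
  then have "act jp_y v = 0"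
    using simple[OF submodule_kernel_y] by blast
  note act_v = act_common_eigenvector[OF v(2) this]
  have "submodule act (vs.span {v})"
  proof -
    have "act r u \<in> vs.span {v}" if u: "u \<in> vs.span {v}" for r u
    proof -
      obtain c where "u = jp_scale act c v"
        using u by (auto simp: vs.span_singleton)
      then have "act r u = jp_scale act c (act r v)"
        unfolding jp_scale_def by (metis act_mult jp_scalar_commutes)
      also have "\<dots> \<in> vs.span {v}"
        unfolding act_v[of r] by (intro vs.span_scale vs.span_base) simp
      finally show ?thesis .
    qed
    then show ?thesis
      by (simp add: submodule_def vs.span_zero vs.span_add)
  qed
  moreover have "vs.span {v} \<noteq> {0}"
    using v(1) vs.span_base[of v "{v}"] by auto
  ultimately have span_v: "vs.span {v} = UNIV"
    using simple by blast
  have "vs.independent {v}"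
    using v(1) by simp
  then show "module_dim act = 1"
    unfolding module_dim_def using vs.dim_eq_card[of "{v}" UNIV] span_v vs.span_UNIV by simp
  define g where "g c = jp_scale act c v" for c
  have "inj g"
    using v(1) by (auto simp: g_def inj_def)
  moreover have "surj g"
    using span_v vs.span_singleton[of v] by (simp add: g_def)
  ultimately have g: "bij g"
    by (simp add: bij_def)
  interpret S: left_module "S_mod \<alpha>" by (rule left_module_S_mod)
  have g_add: "g (a + b) = g a + g b" for a b
    by (simp add: g_def vs.scale_left_distrib)
  have g_act: "g (S_mod \<alpha> r c) = act r (g c)" for r c
  proof -
    have "S_mod \<alpha> r c = c * S_mod \<alpha> r 1"
      by transfer simp
    then have "g (S_mod \<alpha> r c) = jp_scale act c (act r v)"
      by (simp add: g_def act_v)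
    also have "\<dots> = act r (g c)"
      unfolding g_def jp_scale_def by (metis act_mult jp_scalar_commutes)
    finally show ?thesis .
  qed
  have gi: "g (inv g u) = u" "inv g (g c) = c" for u c
    using g by (simp_all add: bij_is_surj surj_f_inv_f bij_is_inj)
  have "isomorphic_modules act (S_mod \<alpha>)"
    unfolding isomorphic_modules_def
  proof (intro exI[of _ "inv g"] conjI allI)
    show "bij (inv g)"
      using g by (rule bij_imp_bij_inv)
    show "inv g (u + w) = inv g u + inv g w" for u w
      by (metis g_add gi)
    show "inv g (act r u) = S_mod \<alpha> r (inv g u)" for r u
      by (metis g_act gi)
  qed
  then show "\<exists>\<alpha>. isomorphic_modules act (S_mod \<alpha>)" ..
qed

lemma irreducible_S_mod: "irreducible_module (S_mod \<alpha>)"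
  unfolding irreducible_module_def
proof (intro conjI allI impI)
  show "left_module (S_mod \<alpha>)"
    by (rule left_module_S_mod)
  show "(UNIV :: 'a set) \<noteq> {0}"
    using UNIV_I[of "1 :: 'a"] by (metis singletonD zero_neq_one)
next
  fix N
  assume N: "submodule (S_mod \<alpha>) N"
  show "N = {0} \<or> N = UNIV"
  proof (cases "N \<subseteq> {0}")
    case True
    then show ?thesis
      using N by (auto simp: submodule_def)
  next
    case False
    then obtain v where v: "v \<in> N" "v \<noteq> 0"
      by blast
    have "jp_scale (S_mod \<alpha>) (u / v) v \<in> N" for u
      using N v unfolding submodule_def jp_scale_def by blast
    then have "u \<in> N" for u
      using v by (simp add: S_mod_scalar)
    then show ?thesis by blast
  qed
qed

lemma finite_dimensional_S_mod: "finite_dimensional_module (S_mod \<alpha>)"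
proof -
  interpret jordan_plane_module "S_mod \<alpha>"
    by (simp add: jordan_plane_module_def left_module_S_mod)
  have "vs.span {1} = UNIV"
    unfolding vs.span_singleton by (simp add: S_mod_scalar)
  then have "finite_dimensional_vector_space (jp_scale (S_mod \<alpha>)) {1}"
    by unfold_locales simp_all
  then show ?thesis
    unfolding finite_dimensional_module_def by blast
qed

lemma isomorphic_S_mod_imp_eq:
  assumes "isomorphic_modules (S_mod \<alpha>) (S_mod \<beta>)"
  shows "\<alpha> = \<beta>"
proof -
  obtain h where h: "bij h" "\<And>u v. h (u + v) = h u + h v"
    "\<And>r v. h (S_mod \<alpha> r v) = S_mod \<beta> r (h v)"
    using assms unfolding isomorphic_modules_def by blast
  have "h 0 = 0"
    using h(2) by (metis add_0 add_cancel_right_right)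
  then have "h 1 \<noteq> 0"
    using h(1) by (metis bij_is_inj injD zero_neq_one)
  \<comment> \<open>On \<open>S\<^sub>\<alpha>\<close> the elements \<open>x\<close> and the scalar \<open>\<alpha>\<close> both send \<open>1\<close> to \<open>\<alpha>\<close>; on \<open>S\<^sub>\<beta>\<close> they
    multiply by \<open>\<beta>\<close> and \<open>\<alpha>\<close>.\<close>
  have "h \<alpha> = \<beta> * h 1"
    using h(3)[of jp_x 1] by (simp add: S_mod_x)
  moreover have "h \<alpha> = \<alpha> * h 1"
    using h(3)[of "jp_scalar \<alpha>" 1] S_mod_scalar[of _ \<alpha>] by (simp add: jp_scale_def)
  ultimately show ?thesis
    using \<open>h 1 \<noteq> 0\<close> by simp
qed

theorem mainTheorem3:
  shows "(\<forall>M :: 'k::{alg_closed_field,field_char_0} jordan_plane \<Rightarrow> 'm::ab_group_add \<Rightarrow> 'm.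
            irreducible_module M \<and> finite_dimensional_module M \<longrightarrow>
              module_dim M = 1 \<and> (\<exists>\<alpha>. isomorphic_modules M (S_mod \<alpha>))) \<and>
         (\<forall>\<alpha>::'k. irreducible_module (S_mod \<alpha>) \<and> finite_dimensional_module (S_mod \<alpha>)) \<and>
         (\<forall>\<alpha> \<beta> :: 'k. \<alpha> \<noteq> \<beta> \<longrightarrow> \<not> isomorphic_modules (S_mod \<alpha>) (S_mod \<beta>))"
proof (intro conjI allI impI)
  fix M :: "'k jordan_plane \<Rightarrow> 'm \<Rightarrow> 'm"
  assume "irreducible_module M \<and> finite_dimensional_module M"
  then have M: "irreducible_module M" "finite_dimensional_module M"
    by simp_all
  show "module_dim M = 1"
    using M by (rule irreducible_finite_dimensional_jordan_plane(1))
  show "\<exists>\<alpha>. isomorphic_modules M (S_mod \<alpha>)"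
    using M by (rule irreducible_finite_dimensional_jordan_plane(2))
next
  fix \<alpha> :: 'k
  show "irreducible_module (S_mod \<alpha>)"
    by (rule irreducible_S_mod)
  show "finite_dimensional_module (S_mod \<alpha>)"
    by (rule finite_dimensional_S_mod)
next
  fix \<alpha> \<beta> :: 'k
  assume "\<alpha> \<noteq> \<beta>"
  then show "\<not> isomorphic_modules (S_mod \<alpha>) (S_mod \<beta>)"
    using isomorphic_S_mod_imp_eq by (rule contrapos_nn)
qed

end
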